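(* Let $\gamma,\alpha$ be umbrae and let $(\gamma,\alpha)$ be the exponential Riordan array they generate. Then for all $n\ge k\ge1$: \[ (\gamma,\alpha)_{n,k}\simeq\frac{n}{k}\sum_{i=0}^{n-k}\binom{n-1}{i}\alpha^i\,(\gamma,\alpha)_{n-1-i,k-1}, \] \[ (\gamma,\alpha)_{n,k}\simeq\frac{n}{k}\sum_{i=0}^{n-k}\binom{k-1+i}{i}\mathfrak K_\alpha^i\,(\gamma,\alpha)_{n-1,k-1+i}, \] \[ (\gamma,\alpha)_{n,k}\simeq\binom{n}{k}\sum_{i=0}^{n-k}(k.\mathfrak K_\alpha)^i\,(\gamma,\alpha)_{n-k,i}. \]
   Context: Classical umbral calculus: $R=\mathbb{C}[x]$, $A$ a saturated alphabet of umbrae, $E:R[A]\to R$ linear with $E[1]=1$ and $E[\alpha^i\beta^j\cdots]=E[\alpha^i]E[\beta^j]\cdots$ for distinct umbrae; $p\simeq q$ means $E[p]=E[q]$. $f_\alpha(t)=\sum_n E[\alpha^n]t^n/n!$. For an integer $x$ (possibly negative), $x.\alpha$ is an umbra with $(x.\alpha)^n\simeq n![t^n]f_\alpha(t)^x$. For umbrae $\sigma,\alpha$, $\mathfrak K_{\sigma,\alpha}$ is an umbra with $\mathfrak K_{\sigma,\alpha}^0=1$ and $\mathfrak K_{\sigma,\alpha}^n\simeq\sigma(\sigma+(-n).\alpha)^{n-1}$ for $n\ge1$ ($(-n).\alpha$ uncorrelated with $\sigma$); $\mathfrak K_\alpha:=\mathfrak K_{\alpha,\alpha}$. The exponential Riordan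 array $(\gamma,\alpha)$ is the lower triangular matrix with entries $(\gamma,\alpha)_{n,k}=E\big[\binom{n}{k}(\gamma+k.\alpha)^{n-k}\big]\in R$ for $n\ge k\ge0$, with $\gamma$ and $k.\alpha$ uncorrelated; in classical terms $(\gamma,\alpha)_{n,k}=n![t^n]f_\gamma(t)\frac{(tf_\alpha(t))^k}{k!}$. *)

theory Defs
  imports
    Complex_Main
    "HOL-Library.Poly_Mapping"
    "HOL-Computational_Algebra.Computational_Algebra"
begin

text \<open>
  The coefficient ring is \<open>R = \<complex>[x]\<close>, rendered as \<^typ>\<open>complex poly\<close>. The alphabet \<open>A\<close> is the
  set of all elements of a type \<open>'a\<close>, and \<open>R[A]\<close> is the monoid algebra over \<open>R\<close> of the
  finitely supported exponent vectors \<open>'a \<Rightarrow>\<^sub>0 nat\<close>.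
\<close>

type_synonym 'a umbral_poly = "('a \<Rightarrow>\<^sub>0 nat) \<Rightarrow>\<^sub>0 complex poly"

definition umb :: "'a \<Rightarrow> 'a umbral_poly" where
  "umb \<alpha> = Poly_Mapping.single (Poly_Mapping.single \<alpha> 1) 1"

definition scal :: "complex poly \<Rightarrow> 'a umbral_poly" where
  "scal c = Poly_Mapping.single 0 c"

locale umbral_calculus =
  fixes E :: "'a umbral_poly \<Rightarrow> complex poly"
  assumes E_add: "E (p + q) = E p + E q"
    and E_scal: "E (scal c * p) = c * E p"
    and E_one: "E 1 = 1"
    and E_uncorrelated:
      "finite S \<Longrightarrow> E (\<Prod>\<alpha>\<in>S. umb \<alpha> ^ i \<alpha>) = (\<Prod>\<alpha>\<in>S. E (umb \<alpha> ^ i \<alpha>))"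
    and saturated:
      "a 0 = 1 \<Longrightarrow> infinite {\<alpha>. \<forall>n. E (umb \<alpha> ^ n) = a n}"

definition umbral_equiv ::
    "'a umbral_poly \<Rightarrow> ('a umbral_poly \<Rightarrow> complex poly) \<Rightarrow> 'a umbral_poly \<Rightarrow> bool"
    ("(_ \<simeq>\<^bsub>_\<^esub> _)" [51, 0, 51] 50) where
  "p \<simeq>\<^bsub>E\<^esub> q \<longleftrightarrow> E p = E q"

definition gen_fun :: "('a umbral_poly \<Rightarrow> complex poly) \<Rightarrow> 'a \<Rightarrow> complex poly fps" where
  "gen_fun E \<alpha> = Abs_fps (\<lambda>n. smult (1 / fact n) (E (umb \<alpha> ^ n)))"

text \<open>
  Integer powers of a power series with constant term 1. The type \<^typ>\<open>complex poly\<close> has no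
  \<^const>\<open>inverse\<close>, hence the ring version of the inverse of a power series, whose second argument
  is the inverse of the constant term.
\<close>

definition fps_int_pow :: "'a::comm_ring_1 fps \<Rightarrow> int \<Rightarrow> 'a fps" where
  "fps_int_pow f x = (if 0 \<le> x then f ^ nat x else fps_left_inverse f 1 ^ nat (- x))"

definition is_dot :: "('a umbral_poly \<Rightarrow> complex poly) \<Rightarrow> int \<Rightarrow> 'a \<Rightarrow> 'a \<Rightarrow> bool" where
  "is_dot E x \<alpha> \<beta> \<longleftrightarrow>
    (\<forall>n. E (umb \<beta> ^ n) = smult (fact n) (fps_nth (fps_int_pow (gen_fun E \<alpha>) x) n))"

text \<open>
  The umbra \<open>x.\<alpha>\<close>. The finite set \<open>F\<close> lists the umbrae from which \<open>x.\<alpha>\<close> has to be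
  uncorrelated, that is, distinct.
\<close>

definition dot :: "('a umbral_poly \<Rightarrow> complex poly) \<Rightarrow> 'a set \<Rightarrow> int \<Rightarrow> 'a \<Rightarrow> 'a" where
  "dot E F x \<alpha> = (SOME \<beta>. \<beta> \<notin> F \<and> is_dot E x \<alpha> \<beta>)"

definition is_K_umbra :: "('a umbral_poly \<Rightarrow> complex poly) \<Rightarrow> 'a \<Rightarrow> 'a \<Rightarrow> 'a \<Rightarrow> bool" where
  "is_K_umbra E \<sigma> \<alpha> \<kappa> \<longleftrightarrow>
    umb \<kappa> ^ 0 = 1 \<and>
    (\<forall>n\<ge>1. umb \<kappa> ^ n \<simeq>\<^bsub>E\<^esub> umb \<sigma> * (umb \<sigma> + umb (dot E {\<sigma>} (- int n) \<alpha>)) ^ (n - 1))"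

definition K_umbra :: "('a umbral_poly \<Rightarrow> complex poly) \<Rightarrow> 'a \<Rightarrow> 'a \<Rightarrow> 'a" where
  "K_umbra E \<sigma> \<alpha> = (SOME \<kappa>. is_K_umbra E \<sigma> \<alpha> \<kappa>)"

definition riordan ::
    "('a umbral_poly \<Rightarrow> complex poly) \<Rightarrow> 'a \<Rightarrow> 'a \<Rightarrow> nat \<Rightarrow> nat \<Rightarrow> complex poly" where
  "riordan E \<gamma> \<alpha> n k =
    (if k \<le> n then E (of_nat (n choose k) * (umb \<gamma> + umb (dot E {\<gamma>} (int k) \<alpha>)) ^ (n - k))
     else 0)"


text \<open>Saturation makes the choices above succeed.\<close>

lemma fps_int_pow_nth_0:
  assumes "fps_nth f 0 = 1"
  shows "fps_nth (fps_int_pow f x) 0 = 1"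
  using assms by (simp add: fps_int_pow_def fps_nth_power_0)

context umbral_calculus
begin

lemma is_dot_dot:
  assumes "finite F"
  shows "dot E F x \<alpha> \<notin> F" and "is_dot E x \<alpha> (dot E F x \<alpha>)"
proof -
  let ?a = "\<lambda>n. smult (fact n) (fps_nth (fps_int_pow (gen_fun E \<alpha>) x) n)"
  have "?a 0 = 1"
    by (simp add: fps_int_pow_nth_0 gen_fun_def E_one)
  from saturated[of ?a, OF this] have "infinite {\<beta>. is_dot E x \<alpha> \<beta>}"
    by (simp add: is_dot_def)
  then have "infinite ({\<beta>. is_dot E x \<alpha> \<beta>} - F)"
    using assms by simp
  then have "{\<beta>. is_dot E x \<alpha> \<beta>} - F \<noteq> {}"
    by (metis finite.emptyI)
  then have "\<exists>\<beta>. \<beta> \<notin> F \<and> is_dot E x \<alpha> \<beta>"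
    by blast
  from someI_ex[OF this]
  show "dot E F x \<alpha> \<notin> F" "is_dot E x \<alpha> (dot E F x \<alpha>)"
    by (simp_all add: dot_def)
qed

lemma is_K_umbra_K_umbra: "is_K_umbra E \<sigma> \<alpha> (K_umbra E \<sigma> \<alpha>)"
proof -
  let ?a = "\<lambda>n. if n = 0 then 1
    else E (umb \<sigma> * (umb \<sigma> + umb (dot E {\<sigma>} (- int n) \<alpha>)) ^ (n - 1))"
  have "infinite {\<kappa>. \<forall>n. E (umb \<kappa> ^ n) = ?a n}"
    by (rule saturated) simp
  then have "{\<kappa>. \<forall>n. E (umb \<kappa> ^ n) = ?a n} \<noteq> {}"
    by (metis (lifting) finite.emptyI)
  then obtain \<kappa> where \<kappa>: "\<And>n. E (umb \<kappa> ^ n) = ?a n"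
    by blast
  have "is_K_umbra E \<sigma> \<alpha> \<kappa>"
    using \<kappa> by (simp add: is_K_umbra_def umbral_equiv_def)
  then show ?thesis
    unfolding K_umbra_def by (rule someI)
qed

end


text \<open>A model of the axioms: an umbra is a moment sequence together with an index.\<close>

definition model_moment :: "(nat \<Rightarrow> complex poly) \<times> nat \<Rightarrow> nat \<Rightarrow> complex poly" where
  "model_moment \<alpha> n = (if n = 0 then 1 else fst \<alpha> n)"

definition model_mono :: "((nat \<Rightarrow> complex poly) \<times> nat \<Rightarrow>\<^sub>0 nat) \<Rightarrow> complex poly" where
  "model_mono m = (\<Prod>\<alpha>\<in>Poly_Mapping.keys m. model_moment \<alpha> (Poly_Mapping.lookup m \<alpha>))"

definition model_E :: "((nat \<Rightarrow> complex poly) \<times> nat) umbral_poly \<Rightarrow> complex poly" where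
  "model_E p = (\<Sum>m\<in>Poly_Mapping.keys p. Poly_Mapping.lookup p m * model_mono m)"

lemma model_E_superset:
  assumes "finite T" "Poly_Mapping.keys p \<subseteq> T"
  shows "model_E p = (\<Sum>m\<in>T. Poly_Mapping.lookup p m * model_mono m)"
  unfolding model_E_def using assms by (intro sum.mono_neutral_left) (auto simp: in_keys_iff)

lemma model_mono_superset:
  assumes "finite T" "Poly_Mapping.keys m \<subseteq> T"
  shows "model_mono m = (\<Prod>\<alpha>\<in>T. model_moment \<alpha> (Poly_Mapping.lookup m \<alpha>))"
  unfolding model_mono_def using assms
  by (intro prod.mono_neutral_left) (auto simp: in_keys_iff model_moment_def)

lemma model_E_single: "model_E (Poly_Mapping.single m c) = c * model_mono m"
  by (subst model_E_superset[of "{m}"]) auto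

lemma umb_power: "umb \<alpha> ^ n = Poly_Mapping.single (Poly_Mapping.single \<alpha> n) 1"
  by (induction n) (simp_all add: umb_def mult_single flip: single_add)

lemma prod_umb_power:
  "finite S \<Longrightarrow> (\<Prod>\<alpha>\<in>S. umb \<alpha> ^ i \<alpha>)
    = Poly_Mapping.single (\<Sum>\<alpha>\<in>S. Poly_Mapping.single \<alpha> (i \<alpha>)) 1"
  by (induction S rule: finite_induct) (simp_all add: umb_power mult_single)

lemma lookup_sum_single:
  "finite S \<Longrightarrow> Poly_Mapping.lookup (\<Sum>\<alpha>\<in>S. Poly_Mapping.single \<alpha> (i \<alpha> :: nat)) \<beta>
    = (if \<beta> \<in> S then i \<beta> else 0)"
  by (induction S rule: finite_induct) (auto simp: lookup_add lookup_single when_def)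

lemma model_E_umb_power: "model_E (umb \<alpha> ^ n) = model_moment \<alpha> n"
  unfolding umb_power model_E_single
  by (subst model_mono_superset[of "{\<alpha>}"]) auto

lemma umbral_calculus_model: "umbral_calculus model_E"
proof
  fix p q :: "((nat \<Rightarrow> complex poly) \<times> nat) umbral_poly"
  let ?T = "Poly_Mapping.keys p \<union> Poly_Mapping.keys q"
  have "model_E (p + q) = (\<Sum>m\<in>?T. Poly_Mapping.lookup (p + q) m * model_mono m)"
    by (rule model_E_superset) (use Poly_Mapping.keys_add[of p q] in auto)
  also have "\<dots> = model_E p + model_E q"
    by (simp add: model_E_superset[of ?T] lookup_add sum.distrib ring_distribs)
  finally show add: "model_E (p + q) = model_E p + model_E q" .
next
  fix c and p :: "((nat \<Rightarrow> complex poly) \<times> nat) umbral_poly"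
  have lk: "Poly_Mapping.lookup (scal c * p) m = c * Poly_Mapping.lookup p m" for m
    by (simp add: scal_def mult_map_scale_conv_mult[symmetric] Poly_Mapping.map.rep_eq when_def)
  have "model_E (scal c * p)
      = (\<Sum>m\<in>Poly_Mapping.keys p. Poly_Mapping.lookup (scal c * p) m * model_mono m)"
    by (rule model_E_superset) (auto simp: in_keys_iff lk)
  then show "model_E (scal c * p) = c * model_E p"
    by (simp add: lk model_E_def sum_distrib_left mult.assoc)
next
  show "model_E 1 = 1"
    by (simp add: model_E_def model_mono_def)
next
  fix S :: "((nat \<Rightarrow> complex poly) \<times> nat) set" and i
  assume S: "finite S"
  have "model_mono (\<Sum>\<alpha>\<in>S. Poly_Mapping.single \<alpha> (i \<alpha>)) = (\<Prod>\<alpha>\<in>S. model_moment \<alpha> (i \<alpha>))"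
    using S by (subst model_mono_superset[of S])
      (auto simp: in_keys_iff lookup_sum_single split: if_splits)
  then show "model_E (\<Prod>\<alpha>\<in>S. umb \<alpha> ^ i \<alpha>) = (\<Prod>\<alpha>\<in>S. model_E (umb \<alpha> ^ i \<alpha>))"
    using S by (simp add: prod_umb_power model_E_single model_E_umb_power)
next
  fix a :: "nat \<Rightarrow> complex poly"
  assume "a 0 = 1"
  then have "range (Pair a) \<subseteq> {\<alpha>. \<forall>n. model_E (umb \<alpha> ^ n) = a n}"
    by (auto simp: model_E_umb_power model_moment_def)
  moreover have "infinite (range (Pair a :: nat \<Rightarrow> _))"
    by (rule range_inj_infinite) (simp add: inj_on_def)
  ultimately show "infinite {\<alpha>. \<forall>n. model_E (umb \<alpha> ^ n) = a n}"
    using finite_subset by blast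
qed

end

theory Submission
  imports Defs
begin

text \<open>
  Write \<open>f\<close> and \<open>g\<close> for the generating functions of \<open>\<alpha>\<close> and \<open>\<gamma>\<close>. Then
  \<open>k! (\<gamma>, \<alpha>)\<^sub>n\<^sub>,\<^sub>k = n! [t\<^sup>n] g (t f)\<^sup>k\<close>, and \<open>j\<close> of the factors \<open>t f\<close> can be split off as \<open>t\<^sup>j f\<^sup>j\<close>.
  Expanding \<open>f\<^sup>j\<close> in powers of \<open>t\<close> and taking \<open>j = 1\<close> gives the first identity. By Lagrange
  inversion the generating function \<open>\<kappa>\<close> of \<open>\<KK>\<^sub>\<alpha>\<close> satisfies \<open>\<kappa>(t f) = f\<close>. Expanding
  \<open>f\<^sup>j = \<kappa>(t f)\<^sup>j\<close> in powers of \<open>t f\<close> gives the second identity for \<open>j = 1\<close> and the third for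
  \<open>j = k\<close>.
\<close>

lemma of_nat_binomial_fact_lemma:
  "k \<le> n \<Longrightarrow> fact k * fact (n - k) * of_nat (n choose k) = (fact n :: 'a::semiring_char_0)"
  by (metis binomial_fact_lemma of_nat_fact of_nat_mult)

lemma fact_mult_fps_mult_nth:
  fixes f g :: "'a::{comm_semiring_1,semiring_char_0} fps"
  shows "fact n * (f * g) $ n
    = (\<Sum>i=0..n. of_nat (n choose i) * (fact i * f $ i) * (fact (n - i) * g $ (n - i)))"
  unfolding fps_mult_nth sum_distrib_left
  by (intro sum.cong refl) (simp add: ac_simps flip: of_nat_binomial_fact_lemma)

lemma fact_mult_fps_nth_deriv_nth:
  fixes f :: "'a::{comm_semiring_1,semiring_char_0} fps"
  shows "fact i * fps_nth_deriv r f $ i = fact (r + i) * f $ (r + i)"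
  by (induction r arbitrary: f) (simp_all add: ac_simps)

lemma fps_mult_X_mult_power_nth:
  fixes c f :: "'a::comm_ring_1 fps"
  shows "(c * (fps_X * f) ^ k) $ n = (if n < k then 0 else (c * f ^ k) $ (n - k))"
  by (simp only: power_mult_distrib mult.left_commute[of c] fps_X_power_mult_nth)

lemma fps_mult_compose_nth:
  fixes a b c :: "'a::comm_ring_1 fps"
  assumes "b $ 0 = 0"
  shows "(c * (a oo b)) $ n = (\<Sum>i=0..n. a $ i * (c * b ^ i) $ n)"
proof -
  have "(a oo b) $ j = (\<Sum>i=0..n. a $ i * (b ^ i) $ j)" if "j \<le> n" for j
    unfolding fps_compose_nth
    by (rule sum.mono_neutral_left) (use that startsby_zero_power_prefix[OF assms] in auto)
  then have "(c * (a oo b)) $ n = (\<Sum>j=0..n. \<Sum>i=0..n. c $ j * (a $ i * (b ^ i) $ (n - j)))"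
    by (simp add: fps_mult_nth sum_distrib_left)
  also have "\<dots> = (\<Sum>i=0..n. \<Sum>j=0..n. c $ j * (a $ i * (b ^ i) $ (n - j)))"
    by (rule sum.swap)
  also have "\<dots> = (\<Sum>i=0..n. a $ i * (c * b ^ i) $ n)"
    by (simp add: fps_mult_nth sum_distrib_left ac_simps)
  finally show ?thesis .
qed

text \<open>
  In residue notation this is \<open>Res (t f)\<^bsup>-m-1\<^esup> d(t f)\<close>, which vanishes for \<open>m > 0\<close> because the
  integrand is then exact.
\<close>

lemma fps_X_mult_residue:
  fixes f :: "'a::{idom,ring_char_0} fps"
  assumes "x * f $ 0 = 1"
  shows "(fps_deriv (fps_X * f) * fps_left_inverse f x ^ Suc m) $ m = (if m = 0 then 1 else 0)"
proof -
  define w where "w = fps_left_inverse f x"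
  have "f * w = 1"
    using fps_left_inverse[OF assms] by (simp add: w_def mult.commute)
  moreover have "fps_deriv (fps_X * f) * w ^ Suc m
      = (f * w) * w ^ m + fps_X * (fps_deriv f * w ^ Suc m)"
    by (simp add: algebra_simps)
  ultimately have expand: "fps_deriv (fps_X * f) * w ^ Suc m
      = w ^ m + fps_X * (fps_deriv f * w ^ Suc m)"
    by simp
  have "fps_deriv (w ^ m) = of_nat m * fps_deriv w * w ^ (m - 1)"
    by (rule fps_deriv_power')
  also have "fps_deriv w = - fps_deriv f * w\<^sup>2"
    unfolding w_def by (rule fps_deriv_lr_inverse_comm(1)[OF assms])
  also have "of_nat m * (- fps_deriv f * w\<^sup>2) * w ^ (m - 1)
      = - (of_nat m * (fps_deriv f * w ^ Suc m))"
    by (cases m) (simp_all add: power2_eq_square ac_simps del: of_nat_Suc)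
  finally have exact: "of_nat m * (fps_deriv f * w ^ Suc m) = - fps_deriv (w ^ m)"
    by simp
  have "of_nat m * (fps_deriv (fps_X * f) * w ^ Suc m)
      = of_nat m * w ^ m - fps_X * fps_deriv (w ^ m)"
    unfolding expand distrib_left mult.left_commute[of "of_nat m" fps_X] exact by simp
  then have "of_nat m * (fps_deriv (fps_X * f) * w ^ Suc m) $ m
      = (of_nat m * w ^ m - fps_X * fps_deriv (w ^ m)) $ m"
    by (metis fps_mult_of_nat_nth(1))
  also have "\<dots> = 0"
    by simp
  finally show ?thesis
    unfolding w_def[symmetric] using expand by (cases "m = 0") simp_all
qed

lemma fps_X_mult_residue_power:
  fixes f :: "'a::{idom,ring_char_0} fps"
  assumes "x * f $ 0 = 1"
  shows "(fps_deriv (fps_X * f) * fps_left_inverse f x ^ Suc n * (fps_X * f) ^ i) $ n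
    = (if i = n then 1 else 0)"
proof (cases "i \<le> n")
  case True
  define u' w where "u' = fps_deriv (fps_X * f)" and "w = fps_left_inverse f x"
  have "w * f = 1"
    unfolding w_def by (rule fps_left_inverse[OF assms])
  have "w ^ Suc n = w ^ i * w ^ Suc (n - i)"
    using True by (simp flip: power_add)
  then have "u' * w ^ Suc n * f ^ i = u' * w ^ Suc (n - i) * (w * f) ^ i"
    by (simp only: power_mult_distrib ac_simps)
  then have "u' * w ^ Suc n * f ^ i = u' * w ^ Suc (n - i)"
    by (simp only: \<open>w * f = 1\<close> power_one mult_1_right)
  then have "(u' * w ^ Suc n * (fps_X * f) ^ i) $ n = (u' * w ^ Suc (n - i)) $ (n - i)"
    using True by (simp only: fps_mult_X_mult_power_nth) simp
  then show ?thesis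
    unfolding u'_def w_def fps_X_mult_residue[OF assms] using True by auto
qed (simp add: fps_mult_X_mult_power_nth)

lemma fps_lagrange_nth:
  fixes f h :: "'a::{idom,ring_char_0} fps"
  assumes "x * f $ 0 = 1"
  shows "(fps_deriv (h oo (fps_X * f)) * fps_left_inverse f x ^ Suc n) $ n
    = of_nat (Suc n) * h $ Suc n"
proof -
  define u c where "u = fps_X * f" and "c = fps_deriv u * fps_left_inverse f x ^ Suc n"
  have "u $ 0 = 0"
    by (simp add: u_def)
  then have "fps_deriv (h oo u) * fps_left_inverse f x ^ Suc n = c * (fps_deriv h oo u)"
    by (simp add: fps_compose_deriv c_def ac_simps)
  then have "(fps_deriv (h oo u) * fps_left_inverse f x ^ Suc n) $ n
      = (\<Sum>i=0..n. fps_deriv h $ i * (c * u ^ i) $ n)"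
    by (simp only: fps_mult_compose_nth[OF \<open>u $ 0 = 0\<close>])
  also have "\<dots> = (\<Sum>i=0..n. if i = n then fps_deriv h $ i else 0)"
    unfolding c_def u_def fps_X_mult_residue_power[OF assms] by (intro sum.cong refl) simp
  also have "\<dots> = of_nat (Suc n) * h $ Suc n"
    by simp
  finally show ?thesis
    by (simp only: u_def)
qed

lemma fps_eq_0_if_mult_nth_eq_0:
  fixes d :: "'a::idom fps"
  assumes "\<And>n. v n $ 0 \<noteq> 0" and "\<And>n. (d * v n) $ n = 0"
  shows "d = 0"
proof -
  have "d $ subdegree d * v (subdegree d) $ 0 = 0"
    using assms(2)[of "subdegree d"] by simp
  then show ?thesis
    using assms(1) by simp
qed

text \<open>
  Lagrange inversion with the inverse series eliminated: the usual statement describes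
  \<open>\<kappa> = h \<circ> (t f)\<^bsup>\<langle>-1\<rangle>\<^esup>\<close>. Existence of an expansion of \<open>h\<close> in powers of \<open>t f\<close> is not needed, since
  the functionals \<open>h \<mapsto> [t\<^sup>n] h' f\<^bsup>-n-1\<^esup>\<close> determine \<open>h\<close> up to a constant.
\<close>

theorem fps_lagrange_inversion:
  fixes f h \<kappa> :: "'a::{idom,ring_char_0} fps"
  assumes "x * f $ 0 = 1" and "\<kappa> $ 0 = h $ 0"
    and "\<And>n. of_nat (Suc n) * \<kappa> $ Suc n = (fps_deriv h * fps_left_inverse f x ^ Suc n) $ n"
  shows "\<kappa> oo (fps_X * f) = h"
proof -
  have "fps_deriv (\<kappa> oo (fps_X * f)) - fps_deriv h = 0"
  proof (rule fps_eq_0_if_mult_nth_eq_0)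
    show "(fps_left_inverse f x ^ Suc n) $ 0 \<noteq> 0" for n
      using assms(1) by (auto simp: fps_nth_power_0)
    show "((fps_deriv (\<kappa> oo (fps_X * f)) - fps_deriv h) * fps_left_inverse f x ^ Suc n) $ n = 0"
      for n
      by (simp only: left_diff_distrib fps_sub_nth fps_lagrange_nth[OF assms(1)] assms(3) diff_self)
  qed
  then have "fps_deriv (\<kappa> oo (fps_X * f)) = fps_deriv h"
    by simp
  then show ?thesis
    unfolding fps_deriv_eq_iff by (simp add: assms(2))
qed

lemma eq_divide_mult_if_of_nat_mult_eq:
  fixes p q :: "'a::field_char_0 poly"
  assumes "of_nat k * p = of_nat n * q" and "k \<noteq> 0"
  shows "p = [:of_nat n / of_nat k:] * q"
  using assms smult_eq_iff[of "of_nat k" "of_nat n" q p] by (simp add: of_nat_mult_conv_smult)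

lemma fps_int_pow_of_nat: "fps_int_pow f (int n) = f ^ n"
  by (simp add: fps_int_pow_def)

lemma fps_int_pow_minus_of_nat: "fps_int_pow f (- int n) = fps_left_inverse f 1 ^ n"
  by (cases n) (simp_all add: fps_int_pow_def nat_add_distrib del: power_Suc)

lemma scal_of_nat: "scal (of_nat n) = of_nat n"
  by (induction n) (simp_all add: scal_def single_add)

context umbral_calculus
begin

lemma E_0: "E 0 = 0"
  using E_add[of 0 0] by simp

lemma E_sum: "E (\<Sum>i\<in>S. p i) = (\<Sum>i\<in>S. E (p i))"
  by (induction S rule: infinite_finite_induct) (simp_all add: E_0 E_add)

lemma E_of_nat_mult: "E (of_nat n * p) = of_nat n * E p"
  using E_scal[of "of_nat n" p] by (simp add: scal_of_nat)

lemma E_mult_scal: "E (p * scal c) = E p * c"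
  using E_scal[of c p] by (simp add: mult.commute)

lemma E_scal_eq: "E (scal c) = c"
  using E_scal[of c 1] by (simp add: E_one)

lemma E_umb_power: "E (umb \<alpha> ^ n) = fact n * gen_fun E \<alpha> $ n"
proof -
  have "(fact n :: complex poly) = [:fact n:]"
    by (metis of_nat_fact of_nat_poly)
  then show ?thesis
    by (simp add: gen_fun_def)
qed

lemma gen_fun_nth_0: "gen_fun E \<alpha> $ 0 = 1"
  by (simp add: gen_fun_def E_one)

lemma is_dot_iff_gen_fun_eq:
  "is_dot E x \<alpha> \<beta> \<longleftrightarrow> gen_fun E \<beta> = fps_int_pow (gen_fun E \<alpha>) x"
proof -
  have "E (umb \<beta> ^ n) = smult (fact n) p \<longleftrightarrow> gen_fun E \<beta> $ n = p" for n p
    by (auto simp: gen_fun_def)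
  then show ?thesis
    by (simp add: is_dot_def fps_eq_iff)
qed

lemma is_dot_1: "is_dot E (int 1) \<alpha> \<alpha>"
  unfolding is_dot_iff_gen_fun_eq fps_int_pow_of_nat by simp

lemma gen_fun_dot: "finite F \<Longrightarrow> gen_fun E (dot E F x \<alpha>) = fps_int_pow (gen_fun E \<alpha>) x"
  using is_dot_dot(2) by (simp add: is_dot_iff_gen_fun_eq)

lemma dot_neq: "dot E {\<alpha>} x \<beta> \<noteq> \<alpha>"
  using is_dot_dot(1)[of "{\<alpha>}"] by simp

lemma E_umb_power_mult_umb_power:
  assumes "\<alpha> \<noteq> \<beta>"
  shows "E (umb \<alpha> ^ i * umb \<beta> ^ j) = E (umb \<alpha> ^ i) * E (umb \<beta> ^ j)"
  using E_uncorrelated[of "{\<alpha>, \<beta>}" "\<lambda>x. if x = \<alpha> then i else j"] assms by auto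

lemma E_umb_power_mult_add_power:
  assumes "\<alpha> \<noteq> \<beta>"
  shows "E (umb \<alpha> ^ r * (umb \<alpha> + umb \<beta>) ^ m)
    = fact m * (fps_nth_deriv r (gen_fun E \<alpha>) * gen_fun E \<beta>) $ m"
proof -
  have "umb \<alpha> ^ r * (umb \<alpha> + umb \<beta>) ^ m
      = (\<Sum>i=0..m. of_nat (m choose i) * (umb \<alpha> ^ (r + i) * umb \<beta> ^ (m - i)))"
    by (simp add: binomial_ring atLeast0AtMost sum_distrib_left power_add ac_simps)
  then show ?thesis
    by (simp add: E_sum E_of_nat_mult E_umb_power_mult_umb_power[OF assms] E_umb_power
        fact_mult_fps_mult_nth fact_mult_fps_nth_deriv_nth mult.assoc)
qed

lemma gen_fun_K_umbra_nth_Suc: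
  "of_nat (Suc n) * gen_fun E (K_umbra E \<sigma> \<alpha>) $ Suc n
    = (fps_deriv (gen_fun E \<sigma>) * fps_left_inverse (gen_fun E \<alpha>) 1 ^ Suc n) $ n"
proof -
  let ?\<beta> = "dot E {\<sigma>} (- int (Suc n)) \<alpha>"
  have "fact n * (of_nat (Suc n) * gen_fun E (K_umbra E \<sigma> \<alpha>) $ Suc n)
      = E (umb (K_umbra E \<sigma> \<alpha>) ^ Suc n)"
    unfolding E_umb_power by (simp add: ac_simps)
  also have "\<dots> = E (umb \<sigma> ^ 1 * (umb \<sigma> + umb ?\<beta>) ^ n)"
    using is_K_umbra_K_umbra[of \<sigma> \<alpha>] unfolding is_K_umbra_def umbral_equiv_def
    by (metis One_nat_def Suc_le_mono diff_Suc_1 le0 power_one_right)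
  also have "\<dots> = fact n * (fps_nth_deriv 1 (gen_fun E \<sigma>) * gen_fun E ?\<beta>) $ n"
    by (rule E_umb_power_mult_add_power) (rule dot_neq[symmetric])
  finally show ?thesis
    by (simp add: gen_fun_dot fps_int_pow_minus_of_nat del: of_nat_Suc of_nat_add power_Suc)
qed

theorem gen_fun_K_umbra_compose:
  "gen_fun E (K_umbra E \<sigma> \<alpha>) oo (fps_X * gen_fun E \<alpha>) = gen_fun E \<sigma>"
  by (rule fps_lagrange_inversion[where x = 1])
     (simp_all only: gen_fun_K_umbra_nth_Suc gen_fun_nth_0 mult_1)

theorem fact_mult_riordan:
  "fact k * riordan E \<gamma> \<alpha> n k = fact n * (gen_fun E \<gamma> * (fps_X * gen_fun E \<alpha>) ^ k) $ n"
proof (cases "k \<le> n")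
  case True
  let ?\<beta> = "dot E {\<gamma>} (int k) \<alpha>"
  have "E ((umb \<gamma> + umb ?\<beta>) ^ (n - k))
      = fact (n - k) * (gen_fun E \<gamma> * gen_fun E \<alpha> ^ k) $ (n - k)"
    using E_umb_power_mult_add_power[OF dot_neq[symmetric], of \<gamma> 0]
    by (simp add: gen_fun_dot fps_int_pow_of_nat)
  also have "(gen_fun E \<gamma> * gen_fun E \<alpha> ^ k) $ (n - k)
      = (gen_fun E \<gamma> * (fps_X * gen_fun E \<alpha>) ^ k) $ n"
    using True by (simp add: fps_mult_X_mult_power_nth)
  finally show ?thesis
    using True
    by (simp add: riordan_def E_of_nat_mult ac_simps flip: of_nat_binomial_fact_lemma[OF True])
next
  case False
  then show ?thesis
    by (simp add: riordan_def fps_mult_X_mult_power_nth)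
qed

lemma sum_binomial_moment_riordan_column:
  "fact l * (\<Sum>i=0..m-l. of_nat (m choose i) * E (umb \<beta> ^ i) * riordan E \<gamma> \<alpha> (m - i) l)
    = fact m * (gen_fun E \<beta> * (gen_fun E \<gamma> * (fps_X * gen_fun E \<alpha>) ^ l)) $ m"
proof -
  have "(\<Sum>i=0..m-l. of_nat (m choose i) * E (umb \<beta> ^ i) * riordan E \<gamma> \<alpha> (m - i) l)
      = (\<Sum>i=0..m. of_nat (m choose i) * E (umb \<beta> ^ i) * riordan E \<gamma> \<alpha> (m - i) l)"
    by (rule sum.mono_neutral_left) (auto simp: riordan_def)
  then show ?thesis
    unfolding fact_mult_fps_mult_nth[of m "gen_fun E \<beta>"] fact_mult_riordan[symmetric]
    by (simp add: sum_distrib_left E_umb_power ac_simps)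
qed

text \<open>For \<open>l = 0\<close> this is the fundamental theorem of exponential Riordan arrays.\<close>

lemma sum_binomial_moment_riordan_row:
  "fact l * (\<Sum>i=0..m-l. of_nat ((l + i) choose i) * E (umb \<beta> ^ i) * riordan E \<gamma> \<alpha> m (l + i))
    = fact m * ((gen_fun E \<beta> oo (fps_X * gen_fun E \<alpha>)) *
        (gen_fun E \<gamma> * (fps_X * gen_fun E \<alpha>) ^ l)) $ m"
proof -
  let ?u = "fps_X * gen_fun E \<alpha>"
  have "(\<Sum>i=0..m-l. of_nat ((l + i) choose i) * E (umb \<beta> ^ i) * riordan E \<gamma> \<alpha> m (l + i))
      = (\<Sum>i=0..m. of_nat ((l + i) choose i) * E (umb \<beta> ^ i) * riordan E \<gamma> \<alpha> m (l + i))"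
    by (rule sum.mono_neutral_left) (auto simp: riordan_def)
  moreover have "fact l * (of_nat ((l + i) choose i) * E (umb \<beta> ^ i) * riordan E \<gamma> \<alpha> m (l + i))
      = gen_fun E \<beta> $ i * (fact m * (gen_fun E \<gamma> * ?u ^ l * ?u ^ i) $ m)" for i
  proof -
    have "fact i * fact l * of_nat ((l + i) choose i) = (fact (l + i) :: complex poly)"
      using of_nat_binomial_fact_lemma[of i "l + i"] by simp
    then have "fact l * (of_nat ((l + i) choose i) * E (umb \<beta> ^ i) * riordan E \<gamma> \<alpha> m (l + i))
        = gen_fun E \<beta> $ i * (fact (l + i) * riordan E \<gamma> \<alpha> m (l + i))"
      by (simp add: E_umb_power ac_simps flip: \<open>_ = fact (l + i)\<close>)
    then show ?thesis
      unfolding fact_mult_riordan by (simp only: power_add mult.assoc)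
  qed
  ultimately have "fact l *
        (\<Sum>i=0..m-l. of_nat ((l + i) choose i) * E (umb \<beta> ^ i) * riordan E \<gamma> \<alpha> m (l + i))
      = fact m * (\<Sum>i=0..m. gen_fun E \<beta> $ i * (gen_fun E \<gamma> * ?u ^ l * ?u ^ i) $ m)"
    by (simp add: sum_distrib_left mult.left_commute)
  also have "\<dots> = fact m * (gen_fun E \<gamma> * ?u ^ l * (gen_fun E \<beta> oo ?u)) $ m"
    by (simp add: fps_mult_compose_nth)
  finally show ?thesis
    by (simp only: mult.commute)
qed

lemma riordan_split_factors:
  assumes "j \<le> k" and "k \<le> n"
  shows "of_nat (k choose j) * (fact (k - j) * riordan E \<gamma> \<alpha> n k)
    = of_nat (n choose j) * (fact (n - j) *
        (gen_fun E \<alpha> ^ j * (gen_fun E \<gamma> * (fps_X * gen_fun E \<alpha>) ^ (k - j))) $ (n - j))"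
proof -
  let ?f = "gen_fun E \<alpha>" and ?g = "gen_fun E \<gamma>"
  let ?c = "(?f ^ j * (?g * (fps_X * ?f) ^ (k - j))) $ (n - j)"
  have "(fps_X * ?f) ^ k = (fps_X * ?f) ^ j * (fps_X * ?f) ^ (k - j)"
    using assms(1) by (simp flip: power_add)
  then have "(?g * (fps_X * ?f) ^ k) $ n = (?g * (fps_X * ?f) ^ (k - j) * (fps_X * ?f) ^ j) $ n"
    by (simp only: ac_simps)
  also have "\<dots> = ?c"
    using assms by (subst fps_mult_X_mult_power_nth) (simp add: mult.commute)
  finally have split: "fact k * riordan E \<gamma> \<alpha> n k = fact n * ?c"
    by (simp only: fact_mult_riordan)
  have "fact j * (of_nat (k choose j) * (fact (k - j) * riordan E \<gamma> \<alpha> n k))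
      = fact k * riordan E \<gamma> \<alpha> n k"
    by (simp add: ac_simps flip: of_nat_binomial_fact_lemma[OF assms(1)])
  also have "\<dots> = fact j * (of_nat (n choose j) * (fact (n - j) * ?c))"
    unfolding split of_nat_binomial_fact_lemma[OF order.trans[OF assms], symmetric]
    by (simp only: ac_simps)
  finally show ?thesis
    by simp
qed

theorem riordan_eq_sum_dot:
  assumes "is_dot E (int j) \<alpha> \<beta>" and "j \<le> k" and "k \<le> n"
  shows "of_nat (k choose j) * riordan E \<gamma> \<alpha> n k = of_nat (n choose j) *
    (\<Sum>i=0..n-k. of_nat ((n - j) choose i) * E (umb \<beta> ^ i) * riordan E \<gamma> \<alpha> (n - j - i) (k - j))"
proof -
  have \<beta>: "gen_fun E \<beta> = gen_fun E \<alpha> ^ j"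
    using assms(1) by (simp add: is_dot_iff_gen_fun_eq fps_int_pow_of_nat)
  have "n - j - (k - j) = n - k"
    using assms(2) by simp
  then have "fact (k - j) * (of_nat (k choose j) * riordan E \<gamma> \<alpha> n k)
      = fact (k - j) * (of_nat (n choose j) * (\<Sum>i=0..n-k.
          of_nat ((n - j) choose i) * E (umb \<beta> ^ i) * riordan E \<gamma> \<alpha> (n - j - i) (k - j)))"
    using riordan_split_factors[OF assms(2,3), of \<gamma> \<alpha>]
      sum_binomial_moment_riordan_column[where l = "k - j" and m = "n - j" and \<beta> = \<beta>]
    by (simp only: \<beta> mult.left_commute[of "fact _" "of_nat _"])
  then show ?thesis
    by simp
qed

theorem riordan_eq_sum_dot_K_umbra:
  assumes "is_dot E (int j) (K_umbra E \<alpha> \<alpha>) \<beta>" and "j \<le> k" and "k \<le> n"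
  shows "of_nat (k choose j) * riordan E \<gamma> \<alpha> n k = of_nat (n choose j) *
    (\<Sum>i=0..n-k. of_nat ((k - j + i) choose i) * E (umb \<beta> ^ i) * riordan E \<gamma> \<alpha> (n - j) (k - j + i))"
proof -
  have "gen_fun E \<beta> oo (fps_X * gen_fun E \<alpha>)
      = (gen_fun E (K_umbra E \<alpha> \<alpha>) oo (fps_X * gen_fun E \<alpha>)) ^ j"
    using assms(1) by (simp add: is_dot_iff_gen_fun_eq fps_int_pow_of_nat fps_compose_power)
  then have \<beta>: "gen_fun E \<beta> oo (fps_X * gen_fun E \<alpha>) = gen_fun E \<alpha> ^ j"
    by (simp only: gen_fun_K_umbra_compose)
  have "n - j - (k - j) = n - k"
    using assms(2) by simp
  then have "fact (k - j) * (of_nat (k choose j) * riordan E \<gamma> \<alpha> n k)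
      = fact (k - j) * (of_nat (n choose j) * (\<Sum>i=0..n-k.
          of_nat ((k - j + i) choose i) * E (umb \<beta> ^ i) * riordan E \<gamma> \<alpha> (n - j) (k - j + i)))"
    using riordan_split_factors[OF assms(2,3), of \<gamma> \<alpha>]
      sum_binomial_moment_riordan_row[where l = "k - j" and m = "n - j" and \<beta> = \<beta>]
    by (simp only: \<beta> mult.left_commute[of "fact _" "of_nat _"])
  then show ?thesis
    by simp
qed

end

theorem theorem2p6:
  fixes E :: "'a umbral_poly \<Rightarrow> complex poly" and \<gamma> \<alpha> :: 'a and n k :: nat
  assumes "umbral_calculus E" and "1 \<le> k" and "k \<le> n"
  shows
    "(scal (riordan E \<gamma> \<alpha> n k) \<simeq>\<^bsub>E\<^esub>
       scal [:of_nat n / of_nat k:] *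
         (\<Sum>i=0..n-k. of_nat ((n-1) choose i) * umb \<alpha> ^ i * scal (riordan E \<gamma> \<alpha> (n-1-i) (k-1))))
   \<and> (scal (riordan E \<gamma> \<alpha> n k) \<simeq>\<^bsub>E\<^esub>
       scal [:of_nat n / of_nat k:] *
         (\<Sum>i=0..n-k. of_nat ((k-1+i) choose i) * umb (K_umbra E \<alpha> \<alpha>) ^ i *
            scal (riordan E \<gamma> \<alpha> (n-1) (k-1+i))))
   \<and> (scal (riordan E \<gamma> \<alpha> n k) \<simeq>\<^bsub>E\<^esub>
       of_nat (n choose k) *
         (\<Sum>i=0..n-k. umb (dot E {} (int k) (K_umbra E \<alpha> \<alpha>)) ^ i *
            scal (riordan E \<gamma> \<alpha> (n-k) i)))"
proof -
  interpret umbral_calculus E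
    by (rule assms(1))
  have "k \<noteq> 0"
    using assms(2) by simp
  let ?K = "K_umbra E \<alpha> \<alpha>"
  have first: "of_nat k * riordan E \<gamma> \<alpha> n k = of_nat n *
      (\<Sum>i=0..n-k. of_nat ((n-1) choose i) * E (umb \<alpha> ^ i) * riordan E \<gamma> \<alpha> (n-1-i) (k-1))"
    using riordan_eq_sum_dot[OF is_dot_1 assms(2,3)] by simp
  have second: "of_nat k * riordan E \<gamma> \<alpha> n k = of_nat n *
      (\<Sum>i=0..n-k. of_nat ((k-1+i) choose i) * E (umb ?K ^ i) * riordan E \<gamma> \<alpha> (n-1) (k-1+i))"
    using riordan_eq_sum_dot_K_umbra[OF is_dot_1 assms(2,3)] by simp
  have third: "riordan E \<gamma> \<alpha> n k = of_nat (n choose k) *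
      (\<Sum>i=0..n-k. E (umb (dot E {} (int k) ?K) ^ i) * riordan E \<gamma> \<alpha> (n-k) i)"
    using riordan_eq_sum_dot_K_umbra[OF is_dot_dot(2)[OF finite.emptyI] order.refl assms(3)]
    by simp
  show ?thesis
    unfolding umbral_equiv_def E_scal E_scal_eq E_of_nat_mult E_sum E_mult_scal
    using eq_divide_mult_if_of_nat_mult_eq[OF first \<open>k \<noteq> 0\<close>]
      eq_divide_mult_if_of_nat_mult_eq[OF second \<open>k \<noteq> 0\<close>] third
    by (intro conjI)
qed

end
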